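(* Let $N, M$ be positive integers and let $E_N=(e_1,\dots,e_N)\in\{-1,+1\}^N$. Put $t=\lfloor N/M\rfloor$ and assume that \[ M\ge 20,\qquad M>\frac{N}{100},\qquad t<100 . \] For $1\le i\le t$ let $\pi_i$ be the proportion of entries equal to $+1$ in the $i$-th block, i.e. \[ \pi_i=\frac{|\{j:\ (i-1)M<j\le iM,\ e_j=+1\}|}{M}, \] and define \[ X_1=4M\sum_{i=1}^t\left(\pi_i-\frac12\right)^2 . \] Then \[ X_1\le 2\cdot 10^4\,\frac{W(E_N)^2}{N}. \]
   Context: For a sequence $E_N=(e_1,\dots,e_N)\in\{-1,+1\}^N$, the well-distribution measure is \[ W(E_N)=\max_{a,b,t}\left|\sum_{j=0}^{t-1}e_{a+jb}\right|, \] where the maximum is taken over all positive integers $a,b,t$ with $1\le a\le a+(t-1)b\le N$. The quantity $X_1$ is the statistic of the NIST "frequency test within a block". In it the sequence is split into $t=\lfloor N/M\rfloor$ consecutive non-overlapping blocks of length $M$, and any remaining entries are discarded. *)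

theory Defs
  imports Complex_Main
begin

text \<open>
  A sequence \<open>E\<^sub>N = (e\<^sub>1, \<dots>, e\<^sub>N)\<close> is represented by a function \<open>e\<close> on the naturals together
  with its length \<open>N\<close>; only the values \<open>e 1, \<dots>, e N\<close> are ever used.
\<close>

definition binary_seq :: "nat \<Rightarrow> (nat \<Rightarrow> int) \<Rightarrow> bool" where
  "binary_seq N e \<longleftrightarrow> (\<forall>j\<in>{1..N}. e j \<in> {-1, 1})"

definition progression_sums :: "nat \<Rightarrow> (nat \<Rightarrow> int) \<Rightarrow> int set" where
  "progression_sums N e =
     {\<bar>\<Sum>j=0..<t. e (a + j * b)\<bar> | a b t.
        1 \<le> a \<and> 1 \<le> b \<and> 1 \<le> t \<and> a + (t - 1) * b \<le> N}"

definition well_distribution :: "nat \<Rightarrow> (nat \<Rightarrow> int) \<Rightarrow> int" where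
  "well_distribution N e = Max (progression_sums N e)"

text \<open>
  For \<open>t = 1\<close> the difference \<open>b\<close> is unbounded, but the set of values is still finite, so
  \<^const>\<open>Max\<close> is the genuine maximum.
\<close>

lemma finite_progression_sums: "finite (progression_sums N e)"
proof -
  define F where "F = (\<lambda>(a, b, t). \<bar>\<Sum>j=0..<t::nat. e (a + j * b)\<bar>)"
  have "progression_sums N e \<subseteq> F ` ({..N} \<times> {..N} \<times> {..N})"
  proof
    fix x assume "x \<in> progression_sums N e"
    then obtain a b t where x: "x = \<bar>\<Sum>j=0..<t. e (a + j * b)\<bar>"
      and abt: "1 \<le> a" "1 \<le> b" "1 \<le> t" "a + (t - 1) * b \<le> N"
      unfolding progression_sums_def by blast
    show "x \<in> F ` ({..N} \<times> {..N} \<times> {..N})"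
    proof (cases "t = 1")
      case True
      then have "x = F (a, 1, 1)" using x by (simp add: F_def)
      moreover have "(a, 1, 1) \<in> {..N} \<times> {..N} \<times> {..N}" using abt by auto
      ultimately show ?thesis by blast
    next
      case False
      have le: "t - 1 \<le> (t - 1) * b" "b \<le> (t - 1) * b"
        using abt False by simp_all
      have "a \<le> N" using abt(4) by linarith
      moreover have "b \<le> N" using le(2) abt(4) by linarith
      moreover have "t \<le> N" using le(1) abt(1,4) by linarith
      ultimately have "(a, b, t) \<in> {..N} \<times> {..N} \<times> {..N}" by simp
      moreover have "x = F (a, b, t)" using x by (simp add: F_def)
      ultimately show ?thesis by blast
    qed
  qed
  then show ?thesis by (rule finite_subset) auto
qed

lemma progression_sums_nonempty:
  assumes "1 \<le> N"
  shows "progression_sums N e \<noteq> {}"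
proof -
  have "\<bar>\<Sum>j=0..<1. e (1 + j * 1)\<bar> \<in> progression_sums N e"
    unfolding progression_sums_def using assms by fastforce
  then show ?thesis by blast
qed

definition block_proportion :: "nat \<Rightarrow> (nat \<Rightarrow> int) \<Rightarrow> nat \<Rightarrow> real" where
  "block_proportion M e i =
     real (card {j. (i - 1) * M < j \<and> j \<le> i * M \<and> e j = 1}) / real M"

definition block_frequency_statistic :: "nat \<Rightarrow> nat \<Rightarrow> (nat \<Rightarrow> int) \<Rightarrow> real" where
  "block_frequency_statistic N M e =
     4 * real M * (\<Sum>i=1..N div M. (block_proportion M e i - 1 / 2)\<^sup>2)"

end

(* With S_i the sum of the entries of the i-th block, pi_i - 1/2 = S_i / (2 M), so the statistic is
   the sum of S_i^2 / M over the t blocks. A block is a progression of difference 1, hence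
   |S_i| <= W and X_1 <= t W^2 / M, while t < 100 and 1 / M < 100 / N. *)
theory Submission
  imports Defs
begin

lemma progression_sum_le_well_distribution:
  assumes "1 \<le> a" "1 \<le> b" "1 \<le> t" "a + (t - 1) * b \<le> N"
  shows "\<bar>\<Sum>j=0..<t. e (a + j * b)\<bar> \<le> well_distribution N e"
  unfolding well_distribution_def
proof (rule Max_ge[OF finite_progression_sums])
  show "\<bar>\<Sum>j=0..<t. e (a + j * b)\<bar> \<in> progression_sums N e"
    unfolding progression_sums_def using assms by blast
qed

text \<open>An entry \<open>e j\<close> in {-1, 1} equals twice the indicator of
  \<open>e j = 1\<close>, minus 1; summing this over \<open>A\<close> turns sums of signs into
  counts.\<close>

lemma sum_pm1_eq_card:
  fixes e :: "'a \<Rightarrow> int"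
  assumes "finite A" "\<And>j. j \<in> A \<Longrightarrow> e j \<in> {-1, 1}"
  shows "sum e A = 2 * int (card {j \<in> A. e j = 1}) - int (card A)"
proof -
  have "sum e A = (\<Sum>j\<in>A. 2 * (if e j = 1 then 1 else 0) - 1)"
    using assms(2) by (intro sum.cong) auto
  also have "\<dots> = 2 * (\<Sum>j\<in>A. if e j = 1 then 1 else 0) - int (card A)"
    by (simp add: sum_subtractf sum_distrib_left)
  also have "(\<Sum>j\<in>A. if e j = 1 then 1 else 0) = int (card {j \<in> A. e j = 1})"
    using assms(1) by (simp add: sum.If_cases Int_def)
  finally show ?thesis .
qed

text \<open>Links the counting statistic to \<open>well_distribution\<close>. The block is indexed
  as \<open>a + j * b\<close> with \<open>b = 1\<close>, the shape occurring in
  \<open>progression_sums\<close>.\<close>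

lemma block_proportion_eq_sum:
  assumes "binary_seq N e" "0 < M" "1 \<le> i" "i * M \<le> N"
  shows "block_proportion M e i - 1 / 2
           = real_of_int (\<Sum>j=0..<M. e ((i - 1) * M + 1 + j * 1)) / (2 * real M)"
proof -
  define A where "A = {(i - 1) * M<..i * M}"
  define S where "S = (\<Sum>j=0..<M. e ((i - 1) * M + 1 + j * 1))"
  define c where "c = card {j. (i - 1) * M < j \<and> j \<le> i * M \<and> e j = 1}"
  \<comment> \<open>Subtraction on naturals truncates, so this relies on
    \<open>1 \<le> i\<close>.\<close>
  have iM: "i * M = (i - 1) * M + M"
    using assms(3) by (cases i) auto
  have "A = {0 + ((i - 1) * M + 1)..<M + ((i - 1) * M + 1)}"
    unfolding A_def iM by auto
  then have "S = sum e A"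
    unfolding S_def
    using sum.shift_bounds_nat_ivl[of e 0 "(i - 1) * M + 1" M] by (simp add: add.commute)
  \<comment> \<open>As \<open>i * M \<le> N\<close>, the block lies in \<open>{1..N}\<close>, where
    the entries are known to be signs.\<close>
  also have "\<dots> = 2 * int (card {j \<in> A. e j = 1}) - int (card A)"
    using assms(1,4) by (intro sum_pm1_eq_card) (auto simp: A_def binary_seq_def)
  also have "{j \<in> A. e j = 1} = {j. (i - 1) * M < j \<and> j \<le> i * M \<and> e j = 1}"
    by (auto simp: A_def)
  also have "card A = M"
    by (simp add: A_def iM)
  finally have "S = 2 * int c - int M"
    unfolding c_def .
  then show ?thesis
    using assms(2) unfolding block_proportion_def S_def[symmetric] c_def[symmetric]
    by (simp add: field_simps)
qed

text \<open>Each block contributes at most \<open>W\<^sup>2 / (4 * (real M)\<^sup>2)\<close>, and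
  the factor \<open>4 * real M\<close> of the statistic reduces the denominator to
  \<open>M\<close>.\<close>

lemma block_frequency_statistic_le:
  assumes "binary_seq N e" "0 < M"
  shows "block_frequency_statistic N M e
           \<le> real (N div M) * (real_of_int (well_distribution N e))\<^sup>2 / real M"
proof -
  define W where "W = real_of_int (well_distribution N e)"
  have "(block_proportion M e i - 1 / 2)\<^sup>2 \<le> W\<^sup>2 / (4 * (real M)\<^sup>2)"
    if "i \<in> {1..N div M}" for i
  proof -
    define S where "S = (\<Sum>j=0..<M. e ((i - 1) * M + 1 + j * 1))"
    have iN: "1 \<le> i" "i * M \<le> N"
      using that assms(2) by (auto simp: less_eq_div_iff_mult_less_eq)
    \<comment> \<open>The left side is the last index of the progression; it equals
      \<open>i * M\<close>, the right end of the block.\<close>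
    have "(i - 1) * M + 1 + (M - 1) * 1 \<le> N"
      using iN assms(2) by (cases i) auto
    then have "\<bar>S\<bar> \<le> well_distribution N e"
      unfolding S_def using assms(2) by (intro progression_sum_le_well_distribution) auto
    then have "\<bar>real_of_int S\<bar> \<le> W"
      by (simp add: W_def flip: of_int_abs)
    \<comment> \<open>The bound on \<open>\<bar>S\<bar>\<close> also forces \<open>W\<close> to be
      nonnegative, so \<open>W\<close> is its own absolute value.\<close>
    then have "(real_of_int S)\<^sup>2 \<le> W\<^sup>2"
      using abs_le_square_iff[of "real_of_int S" W] by linarith
    moreover have "block_proportion M e i - 1 / 2 = real_of_int S / (2 * real M)"
      unfolding S_def using assms iN by (intro block_proportion_eq_sum)
    ultimately show ?thesis
      by (simp add: power_divide power_mult_distrib divide_right_mono)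
  qed
  then have "(\<Sum>i=1..N div M. (block_proportion M e i - 1 / 2)\<^sup>2)
               \<le> real (N div M) * (W\<^sup>2 / (4 * (real M)\<^sup>2))"
    using sum_bounded_above[of "{1..N div M}" "\<lambda>i. (block_proportion M e i - 1 / 2)\<^sup>2"]
    by (metis card_atLeastAtMost add_diff_cancel_right' Suc_eq_plus1)
  then have "block_frequency_statistic N M e
               \<le> 4 * real M * (real (N div M) * (W\<^sup>2 / (4 * (real M)\<^sup>2)))"
    unfolding block_frequency_statistic_def by (intro mult_left_mono) auto
  also have "\<dots> = real (N div M) * W\<^sup>2 / real M"
    using assms(2) by (simp add: power2_eq_square)
  finally show ?thesis
    unfolding W_def .
qed

theorem theorem1:
  fixes N M t :: nat and e :: "nat \<Rightarrow> int"
  assumes "N \<ge> 1" and "M \<ge> 1"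
    and "binary_seq N e"
    and "t = N div M"
    and "M \<ge> 20" and "real M > real N / 100" and "t < 100"
  shows "block_frequency_statistic N M e
           \<le> 2 * 10 ^ 4 * ((real_of_int (well_distribution N e))\<^sup>2 / real N)"
proof -
  define W where "W = real_of_int (well_distribution N e)"
  \<comment> \<open>Enlarge the numerator by \<open>t < 100\<close> and shrink the denominator by
    \<open>M > N / 100\<close>. The result is \<open>10 ^ 4 / N\<close>, half the constant
    claimed.\<close>
  have "real t / real M \<le> 100 / (real N / 100)"
    using assms by (intro frac_le) auto
  also have "\<dots> \<le> 2 * 10 ^ 4 / real N"
    using assms(1) by (simp add: field_simps)
  finally have "real t / real M * W\<^sup>2 \<le> 2 * 10 ^ 4 / real N * W\<^sup>2"
    by (rule mult_right_mono) simp
  moreover have "block_frequency_statistic N M e \<le> real t * W\<^sup>2 / real M"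
    using block_frequency_statistic_le[of N e M] assms by (simp add: W_def)
  ultimately show ?thesis
    by (simp add: W_def)
qed

end
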